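(* Let $G$ be a connected bipartite graph. Then the following assertions are equivalent: (i) $G$ is $\alpha$-stable; (ii) $G$ can be decomposed as $G=G_1\cup\dots\cup G_k$, $k\ge 1$, such that each $G_i$, $1\le i\le k$, is bistable bipartite and has at least $4$ vertices; (iii) $G$ has perfect matchings and $\bigcap\{M : M \text{ is a perfect matching of } G\}=\emptyset$; (iv) from each vertex of $G$ there issue at least two edges which are contained in some perfect matchings of $G$; (v) every vertex of $G$ belongs to some alternating cycle of $G$.
   Context: All graphs are finite, simple and undirected. A stability system of $G$ is a stable (independent) set of maximum size, and $\alpha(G)$ is its cardinality. $G$ is $\alpha^-$-stable if $\alpha(G-e)=\alpha(G)$ for every edge $e\in E(G)$ (where $G-e$ deletes the edge $e$ and keeps all vertices); $G$ is $\alpha^+$-stable if $\alpha(G+e)=\alpha(G)$ for every edge $e$ of the complement $\overline{G}$; $G$ is $\alpha$-stable if it is both $\alpha^-$-stable and $\alpha^+$-stable. A bipartite graph $G=(A,B,E)$ with color classes $A,B$ is bistable if it has exactly two stability systems, namely $A$ and $B$. A decomposition $G=G_1\cup\dots\cup G_k$ means a vertex-disjoint union: the vertex set $V(G)$ is partitioned into $V_1,\dots,V_k$ and $G_i=G[V_i]$ is the subgraph induced by $V_i$; $G$ may have further edges joining different parts. A perfect matching is a matching covering all vertices of $G$. A cycle is alternating if its edges are alternately in and not in a perfect matching of $G$.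
   Formalization: Both color classes of the bipartite graph G are required to be nonempty, which excludes the one-vertex graph: it is vacuously α-stable but has no perfect matching and satisfies none of (ii)–(v). *)

theory Defs
  imports Main "HOL-Library.Disjoint_Sets"
begin

text \<open>A graph is given by its vertex set \<open>V\<close> and its edge set \<open>E\<close>, an edge being an
  unordered pair of distinct vertices.\<close>

definition vertex_pairs :: "'a set \<Rightarrow> 'a set set" where
  "vertex_pairs V = {e. e \<subseteq> V \<and> card e = 2}"

definition finite_simple_graph :: "'a set \<Rightarrow> 'a set set \<Rightarrow> bool" where
  "finite_simple_graph V E \<longleftrightarrow> finite V \<and> E \<subseteq> vertex_pairs V"

definition complement_edges :: "'a set \<Rightarrow> 'a set set \<Rightarrow> 'a set set" where
  "complement_edges V E = vertex_pairs V - E"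

definition induced_edges :: "'a set set \<Rightarrow> 'a set \<Rightarrow> 'a set set" where
  "induced_edges E W = {e \<in> E. e \<subseteq> W}"

definition connected_graph :: "'a set \<Rightarrow> 'a set set \<Rightarrow> bool" where
  "connected_graph V E \<longleftrightarrow>
     V \<noteq> {} \<and> (\<forall>u\<in>V. \<forall>v\<in>V. (u, v) \<in> {(x, y). {x, y} \<in> E}\<^sup>*)"

definition stable_set :: "'a set \<Rightarrow> 'a set set \<Rightarrow> 'a set \<Rightarrow> bool" where
  "stable_set V E S \<longleftrightarrow> S \<subseteq> V \<and> (\<forall>u\<in>S. \<forall>v\<in>S. {u, v} \<notin> E)"

definition stability_number :: "'a set \<Rightarrow> 'a set set \<Rightarrow> nat" where
  "stability_number V E = Max (card ` {S. stable_set V E S})"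

definition stability_systems :: "'a set \<Rightarrow> 'a set set \<Rightarrow> 'a set set" where
  "stability_systems V E = {S. stable_set V E S \<and> card S = stability_number V E}"

definition alpha_minus_stable :: "'a set \<Rightarrow> 'a set set \<Rightarrow> bool" where
  "alpha_minus_stable V E \<longleftrightarrow>
     (\<forall>e\<in>E. stability_number V (E - {e}) = stability_number V E)"

definition alpha_plus_stable :: "'a set \<Rightarrow> 'a set set \<Rightarrow> bool" where
  "alpha_plus_stable V E \<longleftrightarrow>
     (\<forall>e\<in>complement_edges V E. stability_number V (insert e E) = stability_number V E)"

definition alpha_stable :: "'a set \<Rightarrow> 'a set set \<Rightarrow> bool" where
  "alpha_stable V E \<longleftrightarrow> alpha_minus_stable V E \<and> alpha_plus_stable V E"

text \<open>The colour classes form a partition of \<open>V\<close> into two blocks, so both are nonempty. In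
  particular the one-vertex graph is not bipartite here; it is vacuously \<open>\<alpha>\<close>-stable, but it
  has no perfect matching.\<close>

definition colour_classes :: "'a set \<Rightarrow> 'a set set \<Rightarrow> 'a set \<Rightarrow> 'a set \<Rightarrow> bool" where
  "colour_classes V E A B \<longleftrightarrow>
     A \<noteq> {} \<and> B \<noteq> {} \<and> A \<union> B = V \<and> A \<inter> B = {} \<and>
     (\<forall>e\<in>E. \<exists>a\<in>A. \<exists>b\<in>B. e = {a, b})"

definition bipartite_graph :: "'a set \<Rightarrow> 'a set set \<Rightarrow> bool" where
  "bipartite_graph V E \<longleftrightarrow> (\<exists>A B. colour_classes V E A B)"

definition bistable_bipartite :: "'a set \<Rightarrow> 'a set set \<Rightarrow> bool" where
  "bistable_bipartite V E \<longleftrightarrow>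
     (\<exists>A B. colour_classes V E A B \<and> A \<noteq> B \<and> stability_systems V E = {A, B})"

text \<open>The parts are the subgraphs induced by the \<open>W i\<close>; edges of the graph joining
  different parts are allowed.\<close>

definition vertex_decomposition :: "'a set \<Rightarrow> nat \<Rightarrow> (nat \<Rightarrow> 'a set) \<Rightarrow> bool" where
  "vertex_decomposition V k W \<longleftrightarrow>
     disjoint_family_on W {1..k} \<and> (\<Union>i\<in>{1..k}. W i) = V"

definition matching :: "'a set set \<Rightarrow> 'a set set \<Rightarrow> bool" where
  "matching E M \<longleftrightarrow> M \<subseteq> E \<and> disjoint M"

definition perfect_matching :: "'a set \<Rightarrow> 'a set set \<Rightarrow> 'a set set \<Rightarrow> bool" where
  "perfect_matching V E M \<longleftrightarrow> matching E M \<and> \<Union>M = V"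

text \<open>A cycle is given by the list of its successive vertices; indices are taken modulo the
  length, so \<open>cycle_edge c (length c - 1)\<close> is the closing edge.\<close>

definition cycle_edge :: "'a list \<Rightarrow> nat \<Rightarrow> 'a set" where
  "cycle_edge c i = {c ! (i mod length c), c ! (Suc i mod length c)}"

definition graph_cycle :: "'a set set \<Rightarrow> 'a list \<Rightarrow> bool" where
  "graph_cycle E c \<longleftrightarrow>
     3 \<le> length c \<and> distinct c \<and> (\<forall>i<length c. cycle_edge c i \<in> E)"

definition alternating_cycle :: "'a set \<Rightarrow> 'a set set \<Rightarrow> 'a list \<Rightarrow> bool" where
  "alternating_cycle V E c \<longleftrightarrow> graph_cycle E c \<and>
     (\<exists>M. perfect_matching V E M \<and>
        (\<forall>i<length c. cycle_edge c i \<in> M \<longleftrightarrow> cycle_edge c (Suc i) \<notin> M))"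

end

theory Submission
  imports Defs
begin

text \<open>
  Every assertion is compared with one combinatorial property, called \<open>avoidable_edges\<close> below: the
  graph has a perfect matching, and every single edge is missed by some perfect matching. This is
  the third assertion with the intersection spelled out.

  The bridge between stability and matchings is Hall's theorem in the following form: a bipartite
  graph with colour classes \<open>A\<close>, \<open>B\<close> of equal size has a perfect matching iff no stable set is
  larger than \<open>A\<close> (\<open>ex_perfect_matching\<close> and \<open>perfect_matching_stability_number\<close>). Once \<open>A\<close> and
  \<open>B\<close> are known to be maximum stable sets, applying this to the graph without the edge \<open>e\<close> shows
  that deleting \<open>e\<close> preserves the stability number iff some perfect matching misses \<open>e\<close>. That \<open>A\<close>
  and \<open>B\<close> are maximum stable sets is what stability under adding edges provides. It says that no
  two vertices lie in all stability systems. Stability systems can be uncrossed, so one of them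
  meets \<open>A\<close> only in vertices common to all stability systems, hence in at most one vertex; as this
  vertex has a neighbour in \<open>B\<close>, the set is no larger than \<open>B\<close>.

  A graph with avoidable edges that is not bistable has a stability system \<open>S\<close> different from \<open>A\<close>
  and \<open>B\<close>. Every perfect matching has to match \<open>S \<inter> A\<close> onto \<open>B - S\<close>, so these vertices and the
  remaining ones span two smaller graphs which inherit avoidability, and induction yields the
  decomposition. Conversely, in a bistable graph on at least four vertices an unavoidable edge
  \<open>{a, b}\<close> would give a set \<open>S\<close> that becomes stable, and too large, after deleting the edge; then
  \<open>S - {a}\<close> and \<open>S - {b}\<close> are two distinct but intersecting stability systems, whereas the only
  stability systems are the disjoint colour classes. Perfect matchings of the parts can be glued.

  For the last two assertions, two perfect matchings that differ at a vertex provide two matching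
  edges there, and following their edges alternately traces an alternating cycle through it. In the
  other direction, exchanging the matching edges along an alternating cycle gives a perfect
  matching that misses any prescribed one of them.
\<close>

section \<open>Hall's theorem\<close>

text \<open>The induction of Halmos and Vaughan. If some proper nonempty set \<open>J\<close> of indices has exactly
  \<open>card J\<close> candidates, these are used up by \<open>J\<close>, and counting the candidates of \<open>J \<union> K\<close> shows
  that Hall's condition survives for the rest. If there is no such \<open>J\<close>, the condition has slack one
  and any choice for one index can be made.\<close>

lemma hall_marriage:
  fixes N :: "'i \<Rightarrow> 'b set"
  assumes "finite I" "\<And>i. i \<in> I \<Longrightarrow> finite (N i)"
    and "\<And>J. J \<subseteq> I \<Longrightarrow> card J \<le> card (\<Union>(N ` J))"
  shows "\<exists>f. inj_on f I \<and> (\<forall>i\<in>I. f i \<in> N i)"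
  using assms
proof (induction "card I" arbitrary: I N rule: less_induct)
  case less
  note fin = less.prems(1) and finN = less.prems(2) and hall = less.prems(3)
  consider (empty) "I = {}"
    | (tight) J where "J \<subset> I" "J \<noteq> {}" "card (\<Union>(N ` J)) = card J"
    | (loose) i where "i \<in> I" "\<And>J. J \<subset> I \<Longrightarrow> J \<noteq> {} \<Longrightarrow> card J < card (\<Union>(N ` J))"
    using hall by (metis equals0I le_neq_implies_less psubset_imp_subset)
  then show ?case
  proof cases
    case empty
    then show ?thesis by simp
  next
    case tight
    let ?U = "\<Union>(N ` J)"
    have finJ: "finite J" and JI: "J \<subseteq> I"
      using tight(1) fin finite_subset by auto
    have "\<exists>f. inj_on f J \<and> (\<forall>i\<in>J. f i \<in> N i)"
    proof (rule less.hyps)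
      show "card J < card I" using tight(1) fin by (simp add: psubset_card_mono)
      show "card K \<le> card (\<Union>(N ` K))" if "K \<subseteq> J" for K
        by (rule hall[OF order_trans[OF that JI]])
    qed (use finJ finN JI in auto)
    then obtain f where f: "inj_on f J" "\<forall>i\<in>J. f i \<in> N i" by blast
    have "card K \<le> card (\<Union>((\<lambda>i. N i - ?U) ` K))" if K: "K \<subseteq> I - J" for K
    proof -
      have "finite K" using K fin finite_subset by blast
      have "card J + card K = card (J \<union> K)"
        using K finJ \<open>finite K\<close> by (subst card_Un_disjoint) auto
      also have "\<dots> \<le> card (\<Union>(N ` (J \<union> K)))"
        using hall[of "J \<union> K"] K JI by blast
      also have "\<Union>(N ` (J \<union> K)) = ?U \<union> \<Union>((\<lambda>i. N i - ?U) ` K)"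
        by auto
      also have "card \<dots> \<le> card ?U + card (\<Union>((\<lambda>i. N i - ?U) ` K))"
        by (rule card_Un_le)
      finally show ?thesis using tight(3) by simp
    qed
    moreover have "card (I - J) < card I"
      using tight(2) JI fin by (intro psubset_card_mono) auto
    ultimately obtain g where g: "inj_on g (I - J)" "\<forall>i\<in>I-J. g i \<in> N i - ?U"
      using less.hyps[of "I - J" "\<lambda>i. N i - ?U"] fin finN by auto
    define h where "h i = (if i \<in> J then f i else g i)" for i
    have "inj_on h I"
    proof (rule inj_onI)
      fix x y assume xy: "x \<in> I" "y \<in> I" "h x = h y"
      have cross: "g z \<noteq> f w" if "w \<in> J" "z \<in> I - J" for w z
        using f(2) g(2) that by (metis DiffE UN_I)
      show "x = y"
        using xy f(1) g(1) cross[of x y] cross[of y x]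
        by (auto simp: h_def inj_on_def split: if_splits)
    qed
    moreover have "\<forall>i\<in>I. h i \<in> N i"
      using f(2) g(2) by (auto simp: h_def)
    ultimately show ?thesis by blast
  next
    case loose
    have "card {i} \<le> card (N i)" using hall[of "{i}"] loose(1) by simp
    then obtain x where x: "x \<in> N i"
      by fastforce
    have "card K \<le> card (\<Union>((\<lambda>j. N j - {x}) ` K))" if K: "K \<subseteq> I - {i}" for K
    proof (cases "K = {}")
      case False
      have "K \<subset> I" using K loose(1) by blast
      then have "card K < card (\<Union>(N ` K))" using loose(2) False by blast
      moreover have "\<Union>((\<lambda>j. N j - {x}) ` K) = \<Union>(N ` K) - {x}" by auto
      ultimately show ?thesis by (simp add: card_Diff_singleton_if) linarith
    qed simp
    moreover have "card (I - {i}) < card I"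
      using loose(1) fin by (meson card_Diff1_less)
    ultimately obtain g where g: "inj_on g (I - {i})" "\<forall>j\<in>I-{i}. g j \<in> N j - {x}"
      using less.hyps[of "I - {i}" "\<lambda>j. N j - {x}"] fin finN by auto
    have "inj_on (g(i := x)) (insert i (I - {i}))"
      unfolding inj_on_insert using g by (auto intro: inj_on_fun_updI)
    then have "inj_on (g(i := x)) I" by (simp only: insert_Diff[OF loose(1)])
    moreover have "\<forall>j\<in>I. (g(i := x)) j \<in> N j"
      using g(2) x by auto
    ultimately show ?thesis by blast
  qed
qed

section \<open>Stable sets and colour classes\<close>

lemma stable_set_mono:
  "stable_set V E S \<Longrightarrow> F \<subseteq> E \<Longrightarrow> T \<subseteq> S \<Longrightarrow> stable_set V F T"
  unfolding stable_set_def by blast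

lemma finite_stable_sets: "finite V \<Longrightarrow> finite {S. stable_set V E S}"
  by (rule finite_subset[of _ "Pow V"]) (auto simp: stable_set_def)

text \<open>The stability number is a maximum over a finite nonempty set; the next lemmas replace the
  operator \<open>Max\<close> by its two defining properties.\<close>

lemma stable_set_card_le:
  assumes "finite V" "stable_set V E S"
  shows "card S \<le> stability_number V E"
  unfolding stability_number_def
  using assms finite_stable_sets by (intro Max_ge) auto

lemma ex_stability_system:
  assumes "finite V"
  obtains S where "S \<in> stability_systems V E"
proof -
  have "stable_set V E {}" by (simp add: stable_set_def)
  then have "stability_number V E \<in> card ` {S. stable_set V E S}"
    unfolding stability_number_def
    using assms finite_stable_sets by (intro Max_in) auto
  then show ?thesis using that unfolding stability_systems_def by auto
qed

lemma stability_number_eqI: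
  assumes "finite V" "stable_set V E S" "\<And>T. stable_set V E T \<Longrightarrow> card T \<le> card S"
  shows "stability_number V E = card S"
  unfolding stability_number_def
  using assms finite_stable_sets by (intro Max_eqI) auto

lemma stability_systemsI:
  assumes "finite V" "stable_set V E S" "stability_number V E \<le> card S"
  shows "S \<in> stability_systems V E"
  using assms stable_set_card_le by (fastforce simp: stability_systems_def)

lemma stability_systemsD:
  assumes "S \<in> stability_systems V E"
  shows "stable_set V E S" "card S = stability_number V E" "S \<subseteq> V"
  using assms by (auto simp: stability_systems_def stable_set_def)

lemma colour_classes_sym: "colour_classes V E A B \<Longrightarrow> colour_classes V E B A"
  unfolding colour_classes_def by (simp add: Int_commute Un_commute) (metis insert_commute)

lemma colour_classes_mono: "colour_classes V E A B \<Longrightarrow> F \<subseteq> E \<Longrightarrow> colour_classes V F A B"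
  unfolding colour_classes_def by blast

lemma colour_classes_edge:
  assumes "colour_classes V E A B" "{x, y} \<in> E" "x \<in> A"
  shows "y \<in> B"
proof -
  obtain a b where "a \<in> A" "b \<in> B" "{x, y} = {a, b}"
    using assms(1,2) unfolding colour_classes_def by metis
  moreover have "A \<inter> B = {}" using assms(1) by (simp add: colour_classes_def)
  ultimately show ?thesis using assms(3) by (auto simp: doubleton_eq_iff)
qed

lemma colour_classes_stable:
  assumes "colour_classes V E A B"
  shows "stable_set V E A" "stable_set V E B"
  using colour_classes_edge[OF assms] colour_classes_edge[OF colour_classes_sym[OF assms]] assms
  unfolding colour_classes_def stable_set_def by fast+

lemma colour_classes_finite:
  assumes "colour_classes V E A B" "finite V"
  shows "finite A" "finite B"
  using assms by (auto simp: colour_classes_def)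

lemma colour_classes_edgeE:
  assumes "colour_classes V E A B" "e \<in> E" "v \<in> e"
  obtains w where "e = {v, w}" "v \<noteq> w"
proof -
  obtain a b where "a \<in> A" "b \<in> B" "e = {a, b}"
    using assms unfolding colour_classes_def by blast
  moreover have "a \<noteq> b" using calculation assms(1) by (auto simp: colour_classes_def)
  ultimately show ?thesis using that assms(3) by (auto simp: insert_commute)
qed

section \<open>Perfect matchings of bipartite graphs\<close>

text \<open>Relative to a perfect matching the edge at a vertex is a function of the vertex; working with
  this function turns counting of matched vertices into injectivity arguments.\<close>

definition partner :: "'a set set \<Rightarrow> 'a \<Rightarrow> 'a" where
  "partner M v = (THE w. w \<noteq> v \<and> {v, w} \<in> M)"

lemma perfect_matching_unique:
  assumes "perfect_matching V E M" "e \<in> M" "f \<in> M" "v \<in> e" "v \<in> f"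
  shows "e = f"
  using assms unfolding perfect_matching_def matching_def disjoint_def by blast

lemma partner_eq:
  assumes "colour_classes V E A B" "perfect_matching V E M" "{v, w} \<in> M"
  shows "partner M v = w"
proof -
  have "{v, w} \<in> E" using assms(2,3) by (auto simp: perfect_matching_def matching_def)
  then have "v \<noteq> w" using assms(1) by (metis colour_classes_edgeE insertI1 doubleton_eq_iff)
  then show ?thesis
    unfolding partner_def
    using perfect_matching_unique[OF assms(2) assms(3)]
    by (intro the_equality) (use assms(3) in \<open>auto simp: doubleton_eq_iff\<close>)
qed

lemma partner_edge:
  assumes "colour_classes V E A B" "perfect_matching V E M" "v \<in> V"
  shows "{v, partner M v} \<in> M"
proof -
  obtain e where e: "e \<in> M" "v \<in> e"
    using assms(2,3) by (auto simp: perfect_matching_def)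
  then have "e \<in> E" using assms(2) by (auto simp: perfect_matching_def matching_def)
  then obtain w where "e = {v, w}" using colour_classes_edgeE[OF assms(1)] e by metis
  then show ?thesis using partner_eq[OF assms(1,2)] e by metis
qed

lemma partner_partner:
  assumes "colour_classes V E A B" "perfect_matching V E M" "v \<in> V"
  shows "partner M (partner M v) = v"
  using partner_edge[OF assms] partner_eq[OF assms(1,2)] by (metis insert_commute)

lemma partner_class:
  assumes "colour_classes V E A B" "perfect_matching V E M" "v \<in> A"
  shows "partner M v \<in> B"
proof -
  have "v \<in> V" using assms by (auto simp: colour_classes_def)
  then have "{v, partner M v} \<in> E"
    using partner_edge[OF assms(1,2)] assms(2) by (auto simp: perfect_matching_def matching_def)
  then show ?thesis using colour_classes_edge assms by metis
qed

lemma partner_inj_on: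
  assumes "colour_classes V E A B" "perfect_matching V E M"
  shows "inj_on (partner M) V"
  using partner_partner[OF assms] by (metis inj_on_inverseI)

text \<open>The vertices of \<open>S\<close> in \<open>B\<close> can be replaced by their partners: these lie in \<open>A\<close>, are distinct, and
  are not in \<open>S\<close> because a matching edge is not inside a stable set.\<close>

lemma perfect_matching_stable_card_le:
  assumes cc: "colour_classes V E A B" and pm: "perfect_matching V E M" and "finite V"
    and S: "stable_set V E S"
  shows "card S \<le> card A"
proof -
  have AB: "A \<subseteq> V" "B \<subseteq> V" "A \<inter> B = {}" "A \<union> B = V"
    using cc by (auto simp: colour_classes_def)
  have SV: "S \<subseteq> V" using S by (simp add: stable_set_def)
  have finA: "finite A" using AB \<open>finite V\<close> finite_subset by blast
  let ?p = "partner M"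
  have inj: "inj_on ?p (S \<inter> B)"
    using partner_inj_on[OF cc pm] AB by (meson inf_le2 inj_on_subset order_trans)
  have img: "?p ` (S \<inter> B) \<subseteq> A"
    using partner_class[OF colour_classes_sym[OF cc] pm] by auto
  have "S \<inter> A \<inter> ?p ` (S \<inter> B) = {}"
  proof (rule ccontr)
    assume "S \<inter> A \<inter> ?p ` (S \<inter> B) \<noteq> {}"
    then obtain v where "v \<in> S \<inter> B" "?p v \<in> S" by auto
    moreover have "{v, ?p v} \<in> E"
      using partner_edge[OF cc pm, of v] calculation AB pm
      by (auto simp: perfect_matching_def matching_def)
    ultimately show False using S by (auto simp: stable_set_def)
  qed
  moreover have fins: "finite (S \<inter> A)" "finite (?p ` (S \<inter> B))" "finite S"
    using finA img SV \<open>finite V\<close> finite_subset by auto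
  moreover have "card S = card (S \<inter> A) + card (S \<inter> B)"
    using AB SV fins by (subst card_Un_disjoint[symmetric]) (auto intro: arg_cong[where f=card])
  ultimately have "card S = card (S \<inter> A \<union> ?p ` (S \<inter> B))"
    using inj by (simp add: card_Un_disjoint card_image)
  also have "\<dots> \<le> card A"
    using img finA by (intro card_mono) auto
  finally show ?thesis .
qed

lemma perfect_matching_card_classes:
  assumes cc: "colour_classes V E A B" and "perfect_matching V E M" "finite V"
  shows "card A = card B"
  using perfect_matching_stable_card_le[OF cc assms(2,3) colour_classes_stable(2)[OF cc]]
    perfect_matching_stable_card_le[OF colour_classes_sym[OF cc] assms(2,3) colour_classes_stable(1)[OF cc]]
  by simp

text \<open>Hall's condition holds because \<open>J \<subseteq> A\<close> together with the vertices of \<open>B\<close> not adjacent to \<open>J\<close> is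
  stable, hence not larger than \<open>B\<close>.\<close>

lemma ex_perfect_matching:
  assumes cc: "colour_classes V E A B" and "finite V" and eq: "card A = card B"
    and le: "stability_number V E \<le> card A"
  shows "\<exists>M. perfect_matching V E M"
proof -
  have AB: "A \<subseteq> V" "B \<subseteq> V" "A \<inter> B = {}" "A \<union> B = V"
    using cc by (auto simp: colour_classes_def)
  have fin: "finite A" "finite B" using AB \<open>finite V\<close> finite_subset by auto
  define N where "N a = {b \<in> B. {a, b} \<in> E}" for a
  have hall: "card J \<le> card (\<Union>(N ` J))" if J: "J \<subseteq> A" for J
  proof -
    let ?U = "\<Union>(N ` J)"
    have UB: "?U \<subseteq> B" by (auto simp: N_def)
    have "stable_set V E (J \<union> (B - ?U))"
      unfolding stable_set_def
    proof (intro conjI ballI)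
      show "J \<union> (B - ?U) \<subseteq> V" using J AB by auto
      fix u v assume uv: "u \<in> J \<union> (B - ?U)" "v \<in> J \<union> (B - ?U)"
      show "{u, v} \<notin> E"
      proof
        assume e: "{u, v} \<in> E"
        show False
        proof (cases "u \<in> A")
          case True
          then have "v \<in> B" using colour_classes_edge[OF cc e] by simp
          then show False using True e uv AB J by (auto simp: N_def)
        next
          case False
          then have "u \<in> B" using uv J by auto
          moreover have "{v, u} \<in> E" using e by (simp add: insert_commute)
          moreover have "v \<in> A"
            using colour_classes_edge[OF colour_classes_sym[OF cc] e] calculation by simp
          ultimately show False using uv AB J by (auto simp: N_def)
        qed
      qed
    qed
    then have "card (J \<union> (B - ?U)) \<le> card B"
      using stable_set_card_le[OF \<open>finite V\<close>] le eq by fastforce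
    moreover have "card (J \<union> (B - ?U)) = card J + card (B - ?U)"
      using J AB fin finite_subset by (intro card_Un_disjoint) auto
    moreover have "card (B - ?U) = card B - card ?U" "card ?U \<le> card B"
      using UB fin finite_subset by (auto intro!: card_Diff_subset card_mono)
    ultimately show ?thesis by linarith
  qed
  have "\<exists>f. inj_on f A \<and> (\<forall>a\<in>A. f a \<in> N a)"
    using fin hall by (intro hall_marriage) (auto simp: N_def)
  then obtain f where f: "inj_on f A" "\<forall>a\<in>A. f a \<in> N a" by blast
  have fB: "f ` A = B"
    using f fin eq by (intro card_subset_eq) (auto simp: card_image N_def)
  let ?M = "(\<lambda>a. {a, f a}) ` A"
  have "disjoint ?M"
    unfolding disjoint_def
  proof (intro ballI impI)
    fix e e' assume "e \<in> ?M" "e' \<in> ?M" "e \<noteq> e'"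
    then obtain a a' where "a \<in> A" "a' \<in> A" "e = {a, f a}" "e' = {a', f a'}" "a \<noteq> a'" by auto
    moreover have "f a \<noteq> f a'" using calculation f(1) by (auto dest: inj_onD)
    moreover have "f a \<notin> A" "f a' \<notin> A" using calculation fB AB by auto
    ultimately show "e \<inter> e' = {}" by auto
  qed
  moreover have "?M \<subseteq> E" using f by (auto simp: N_def)
  moreover have "\<Union>?M = V" using fB AB by auto
  ultimately show ?thesis by (auto simp: perfect_matching_def matching_def)
qed

lemma perfect_matching_stability_number:
  assumes cc: "colour_classes V E A B" and pm: "perfect_matching V E M" and "finite V"
  shows "stability_number V E = card A"
  by (rule stability_number_eqI[OF \<open>finite V\<close> colour_classes_stable(1)[OF cc]
      perfect_matching_stable_card_le[OF cc pm \<open>finite V\<close>]])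

text \<open>Lets results about perfect matchings of the graph without an edge be read as results about
  perfect matchings that miss this edge.\<close>

lemma perfect_matching_Diff:
  "perfect_matching V (E - {e}) M \<longleftrightarrow> perfect_matching V E M \<and> e \<notin> M"
  by (auto simp: perfect_matching_def matching_def)

section \<open>Stability and avoidable edges\<close>

definition avoidable_edges :: "'a set \<Rightarrow> 'a set set \<Rightarrow> bool" where
  "avoidable_edges V E \<longleftrightarrow> (\<exists>M. perfect_matching V E M) \<and>
     (\<forall>e\<in>E. \<exists>M. perfect_matching V E M \<and> e \<notin> M)"

lemma avoidable_edges_iff_Inter:
  "avoidable_edges V E \<longleftrightarrow>
     (\<exists>M. perfect_matching V E M) \<and> \<Inter>{M. perfect_matching V E M} = {}"
proof -
  have "M \<subseteq> E" if "perfect_matching V E M" for M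
    using that by (auto simp: perfect_matching_def matching_def)
  then show ?thesis unfolding avoidable_edges_def by blast
qed

text \<open>Uncrossing: for stability systems \<open>S\<close> and \<open>T\<close>, taking the intersection in \<open>A\<close> and the union in
  \<open>B\<close>, or the other way round, gives two stable sets of the same total size, so both are again
  stability systems. A stability system with as few vertices as possible in \<open>A\<close> therefore shares
  all of them with every other one.\<close>

lemma ex_stability_system_least_on_class:
  assumes cc: "colour_classes V E A B" and "finite V"
  shows "\<exists>S\<in>stability_systems V E. \<forall>T\<in>stability_systems V E. S \<inter> A \<subseteq> T"
proof -
  have AB: "A \<inter> B = {}" "A \<union> B = V" using cc by (auto simp: colour_classes_def)
  obtain S where S: "S \<in> stability_systems V E"
    and least: "\<And>T. T \<in> stability_systems V E \<Longrightarrow> card (S \<inter> A) \<le> card (T \<inter> A)"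
    using ex_stability_system[OF \<open>finite V\<close>]
      ex_has_least_nat[of "\<lambda>S. S \<in> stability_systems V E" _ "\<lambda>S. card (S \<inter> A)"] by metis
  have "S \<inter> A \<subseteq> T" if T: "T \<in> stability_systems V E" for T
  proof -
    note SD = stability_systemsD[OF S] and TD = stability_systemsD[OF T]
    have fin: "finite S" "finite T" using SD(3) TD(3) \<open>finite V\<close> finite_subset by auto
    \<comment> \<open>\<open>nAB\<close> covers the mixed pairs: one vertex of such a pair is in both systems.\<close>
    let ?P = "(S \<inter> T \<inter> A) \<union> ((S \<union> T) \<inter> B)" and ?Q = "((S \<union> T) \<inter> A) \<union> (S \<inter> T \<inter> B)"
    have nAB: "{u, v} \<notin> E \<and> {v, u} \<notin> E" if "u \<in> S \<inter> T" "v \<in> S \<union> T" for u v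
      using that SD(1) TD(1) by (auto simp: stable_set_def insert_commute)
    have nA: "{u, v} \<notin> E" if "u \<in> A" "v \<in> A" for u v
      using that colour_classes_stable(1)[OF cc] by (auto simp: stable_set_def)
    have nB: "{u, v} \<notin> E" if "u \<in> B" "v \<in> B" for u v
      using that colour_classes_stable(2)[OF cc] by (auto simp: stable_set_def)
    have P: "stable_set V E ?P" and Q: "stable_set V E ?Q"
      using SD(3) TD(3) nAB nA nB unfolding stable_set_def by blast+
    have "card ?P + card ?Q = card S + card T"
    proof -
      have split: "card X = card (X \<inter> A) + card (X \<inter> B)" if "X \<subseteq> V" for X
      proof -
        have "finite X" using that \<open>finite V\<close> finite_subset by blast
        then show ?thesis
          using that AB by (subst card_Un_disjoint[symmetric]) (auto intro: arg_cong[where f=card])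
      qed
      have uncross: "card (S \<inter> C) + card (T \<inter> C) = card ((S \<union> T) \<inter> C) + card (S \<inter> T \<inter> C)" for C
        using card_Un_Int[of "S \<inter> C" "T \<inter> C"] fin
        by (simp add: Int_Un_distrib Int_ac)
      have "?P \<inter> A = S \<inter> T \<inter> A" "?P \<inter> B = (S \<union> T) \<inter> B"
        "?Q \<inter> A = (S \<union> T) \<inter> A" "?Q \<inter> B = S \<inter> T \<inter> B"
        using AB by auto
      then show ?thesis
        using split[of ?P] split[of ?Q] split[OF SD(3)] split[OF TD(3)] uncross[of A] uncross[of B]
          P[unfolded stable_set_def, THEN conjunct1] Q[unfolded stable_set_def, THEN conjunct1]
        by (simp only:)
    qed
    then have "stability_number V E \<le> card ?P"
      using stable_set_card_le[OF \<open>finite V\<close> Q] SD(2) TD(2) by linarith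
    then have "?P \<in> stability_systems V E"
      using stability_systemsI \<open>finite V\<close> P by blast
    moreover have "?P \<inter> A = S \<inter> T \<inter> A" using AB by blast
    ultimately have "card (S \<inter> A) \<le> card (S \<inter> T \<inter> A)" using least by metis
    then have "S \<inter> T \<inter> A = S \<inter> A"
      using fin by (intro card_seteq) auto
    then show ?thesis by blast
  qed
  then show ?thesis using S by blast
qed

text \<open>If all stability systems contained both \<open>u\<close> and \<open>v\<close>, none would survive the insertion of the edge
  \<open>{u, v}\<close>.\<close>

lemma alpha_plus_stable_separates:
  assumes "alpha_plus_stable V E" "finite V" "u \<in> V" "v \<in> V" "u \<noteq> v"
  shows "\<exists>S\<in>stability_systems V E. u \<notin> S \<or> v \<notin> S"
proof (cases "{u, v} \<in> E")
  case True
  obtain S where "S \<in> stability_systems V E" using ex_stability_system[OF assms(2)] by blast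
  then show ?thesis using True stability_systemsD(1) by (fastforce simp: stable_set_def)
next
  case False
  then have "{u, v} \<in> complement_edges V E"
    using assms(3-5) by (auto simp: complement_edges_def vertex_pairs_def)
  then have eq: "stability_number V (insert {u, v} E) = stability_number V E"
    using assms(1) by (simp add: alpha_plus_stable_def)
  obtain S where S: "S \<in> stability_systems V (insert {u, v} E)"
    using ex_stability_system[OF assms(2)] by blast
  then have "S \<in> stability_systems V E"
    using eq by (auto simp: stability_systems_def stable_set_def)
  moreover have "u \<notin> S \<or> v \<notin> S"
    using stability_systemsD(1)[OF S] by (auto simp: stable_set_def)
  ultimately show ?thesis by blast
qed

text \<open>By uncrossing there is a stability system \<open>S\<close> whose vertices in \<open>A\<close> belong to all stability
  systems, so at most one such vertex \<open>v\<close> exists. A neighbour of \<open>v\<close> in \<open>B\<close> is absent from \<open>S\<close>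
  and makes up for it.\<close>

lemma alpha_plus_stable_class:
  assumes cc: "colour_classes V E A B" and "finite V" and plus: "alpha_plus_stable V E"
    and nbr: "\<And>v. v \<in> A \<Longrightarrow> \<exists>w. {v, w} \<in> E"
  shows "card B = stability_number V E"
proof -
  have AB: "A \<inter> B = {}" "A \<union> B = V" using cc by (auto simp: colour_classes_def)
  have finB: "finite B" using colour_classes_finite[OF cc \<open>finite V\<close>] by simp
  obtain S where S: "S \<in> stability_systems V E"
    and least: "\<And>T. T \<in> stability_systems V E \<Longrightarrow> S \<inter> A \<subseteq> T"
    using ex_stability_system_least_on_class[OF cc \<open>finite V\<close>] by blast
  note SD = stability_systemsD[OF S]
  have "card S \<le> card B"
  proof (cases "S \<inter> A = {}")
    case True
    then have "S \<subseteq> B" using SD(3) AB by auto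
    then show ?thesis using finB by (simp add: card_mono)
  next
    case False
    then obtain v where v: "v \<in> S" "v \<in> A" by auto
    have "x = v" if "x \<in> S \<inter> A" for x
    proof (rule ccontr)
      assume "x \<noteq> v"
      moreover have "x \<in> V" "v \<in> V" using that v AB by blast+
      ultimately obtain T where "T \<in> stability_systems V E" "x \<notin> T \<or> v \<notin> T"
        using alpha_plus_stable_separates[OF plus \<open>finite V\<close>] by blast
      then show False using least that v by blast
    qed
    moreover obtain w where w: "{v, w} \<in> E" using nbr v by blast
    moreover have "w \<in> B" using colour_classes_edge[OF cc w] v by simp
    moreover have "w \<notin> S" using w v SD(1) by (auto simp: stable_set_def)
    ultimately have "S \<subseteq> insert v (B - {w})" using SD(3) AB by auto
    then have "card S \<le> card (insert v (B - {w}))" using finB by (intro card_mono) auto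
    also have "\<dots> \<le> Suc (card (B - {w}))" by (rule card_insert_le_m1[THEN order_trans]) auto
    also have "\<dots> = card B" using finB \<open>w \<in> B\<close> by (metis card_Suc_Diff1)
    finally show ?thesis .
  qed
  then show ?thesis
    using SD(2) stable_set_card_le[OF \<open>finite V\<close> colour_classes_stable(2)[OF cc]] by simp
qed

text \<open>Adding an edge never matters once \<open>A\<close> and \<open>B\<close> are both of maximum size, because a pair of
  vertices cannot lie inside both of them. For deletions Hall's theorem is applied to the graph
  without the edge.\<close>

lemma alpha_stable_iff_avoidable_edges:
  assumes cc: "colour_classes V E A B" and "finite V"
    and nbr: "\<And>v. v \<in> V \<Longrightarrow> \<exists>w. {v, w} \<in> E"
  shows "alpha_stable V E \<longleftrightarrow> avoidable_edges V E"
proof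
  have AB: "A \<inter> B = {}" "A \<union> B = V" using cc by (auto simp: colour_classes_def)
  have cc': "colour_classes V (E - {e}) A B" for e
    by (rule colour_classes_mono[OF cc Diff_subset])
  {
    assume "alpha_stable V E"
    then have minus: "alpha_minus_stable V E" and plus: "alpha_plus_stable V E"
      by (auto simp: alpha_stable_def)
    have "card B = stability_number V E"
      using alpha_plus_stable_class[OF cc \<open>finite V\<close> plus] nbr AB by blast
    moreover have "card A = stability_number V E"
      using alpha_plus_stable_class[OF colour_classes_sym[OF cc] \<open>finite V\<close> plus] nbr AB by blast
    ultimately show "avoidable_edges V E"
      using ex_perfect_matching[OF cc \<open>finite V\<close>] ex_perfect_matching[OF cc' \<open>finite V\<close>] minus
      unfolding avoidable_edges_def alpha_minus_stable_def perfect_matching_Diff by fastforce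
  }
  assume av: "avoidable_edges V E"
  then obtain M where M: "perfect_matching V E M" by (auto simp: avoidable_edges_def)
  have alpha: "stability_number V E = card A"
    by (rule perfect_matching_stability_number[OF cc M \<open>finite V\<close>])
  have "stability_number V (E - {e}) = card A" if "e \<in> E" for e
    using av that perfect_matching_stability_number[OF cc' _ \<open>finite V\<close>]
    unfolding avoidable_edges_def perfect_matching_Diff by blast
  then have "alpha_minus_stable V E" by (simp add: alpha_minus_stable_def alpha)
  moreover have "stability_number V (insert e E) = card A" if "e \<in> complement_edges V E" for e
  proof -
    have "card e = 2" using that by (auto simp: complement_edges_def vertex_pairs_def)
    then have "e \<noteq> {}" by auto
    then have "\<exists>C\<in>{A, B}. \<not> e \<subseteq> C" using AB by blast
    then obtain C where C: "C \<in> {A, B}" "\<not> e \<subseteq> C" by blast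
    have cardC: "card C = card A"
      using C perfect_matching_card_classes[OF cc M \<open>finite V\<close>] by auto
    have "stable_set V E C" using C colour_classes_stable[OF cc] by auto
    then have "stable_set V (insert e E) C" using C(2) by (auto simp: stable_set_def)
    moreover have "card T \<le> card C" if "stable_set V (insert e E) T" for T
      using stable_set_mono[OF that, of E T] perfect_matching_stable_card_le[OF cc M \<open>finite V\<close>] cardC
      by auto
    ultimately show ?thesis using stability_number_eqI[OF \<open>finite V\<close>] cardC by metis
  qed
  then have "alpha_plus_stable V E" by (simp add: alpha_plus_stable_def alpha)
  ultimately show "alpha_stable V E" by (simp add: alpha_stable_def)
qed

section \<open>Decomposition into bistable parts\<close>

lemma induced_edges_induced:
  "U \<subseteq> W \<Longrightarrow> induced_edges (induced_edges E W) U = induced_edges E U"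
  by (auto simp: induced_edges_def)

lemma perfect_matching_induced:
  assumes cc: "colour_classes V E A B" and pm: "perfect_matching V E M" and "W \<subseteq> V"
    and closed: "\<And>v. v \<in> W \<Longrightarrow> partner M v \<in> W"
  shows "perfect_matching W (induced_edges E W) {e \<in> M. e \<subseteq> W}"
proof -
  have "v \<in> \<Union>{e \<in> M. e \<subseteq> W}" if "v \<in> W" for v
    using partner_edge[OF cc pm, of v] that closed[OF that] \<open>W \<subseteq> V\<close> by blast
  then have "\<Union>{e \<in> M. e \<subseteq> W} = W" by blast
  moreover have "disjoint {e \<in> M. e \<subseteq> W}"
    using pm by (auto simp: perfect_matching_def matching_def disjoint_def)
  moreover have "{e \<in> M. e \<subseteq> W} \<subseteq> induced_edges E W"
    using pm by (auto simp: perfect_matching_def matching_def induced_edges_def)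
  ultimately show ?thesis by (simp add: perfect_matching_def matching_def)
qed

lemma avoidable_edges_induced:
  assumes cc: "colour_classes V E A B" and av: "avoidable_edges V E" and "W \<subseteq> V"
    and closed: "\<And>M v. perfect_matching V E M \<Longrightarrow> v \<in> W \<Longrightarrow> partner M v \<in> W"
  shows "avoidable_edges W (induced_edges E W)"
  unfolding avoidable_edges_def
proof (intro conjI ballI)
  have restrict: "perfect_matching W (induced_edges E W) {e \<in> M. e \<subseteq> W}"
    if "perfect_matching V E M" for M
    using perfect_matching_induced[OF cc that \<open>W \<subseteq> V\<close>] closed[OF that] by blast
  show "\<exists>M. perfect_matching W (induced_edges E W) M"
    using av restrict unfolding avoidable_edges_def by blast
  fix e assume "e \<in> induced_edges E W"
  then have "e \<in> E" by (simp add: induced_edges_def)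
  then obtain M where "perfect_matching V E M" "e \<notin> M"
    using av unfolding avoidable_edges_def by blast
  then show "\<exists>M. perfect_matching W (induced_edges E W) M \<and> e \<notin> M"
    using restrict by blast
qed

lemma colour_classes_induced:
  assumes cc: "colour_classes V E A B" and pm: "perfect_matching V E M" and "W \<subseteq> V" "W \<noteq> {}"
    and closed: "\<And>v. v \<in> W \<Longrightarrow> partner M v \<in> W"
  shows "colour_classes W (induced_edges E W) (A \<inter> W) (B \<inter> W)"
proof -
  have AB: "A \<inter> B = {}" "A \<union> B = V" using cc by (auto simp: colour_classes_def)
  obtain v where v: "v \<in> W" using \<open>W \<noteq> {}\<close> by blast
  have "(v \<in> A \<and> partner M v \<in> B) \<or> (v \<in> B \<and> partner M v \<in> A)"
    using v \<open>W \<subseteq> V\<close> AB partner_class[OF cc pm] partner_class[OF colour_classes_sym[OF cc] pm] by blast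
  then have "A \<inter> W \<noteq> {}" "B \<inter> W \<noteq> {}" using v closed[OF v] by blast+
  moreover have "A \<inter> W \<union> B \<inter> W = W" "(A \<inter> W) \<inter> (B \<inter> W) = {}"
    using AB \<open>W \<subseteq> V\<close> by blast+
  moreover have "\<exists>a\<in>A \<inter> W. \<exists>b\<in>B \<inter> W. e = {a, b}" if e: "e \<in> induced_edges E W" for e
  proof -
    obtain a b where "a \<in> A" "b \<in> B" "e = {a, b}" "e \<subseteq> W"
      using cc e unfolding colour_classes_def induced_edges_def by blast
    then show ?thesis by blast
  qed
  ultimately show ?thesis unfolding colour_classes_def by blast
qed

text \<open>A perfect matching sends \<open>S \<inter> A\<close> injectively into \<open>B - S\<close>. Since \<open>S\<close> and \<open>B\<close> have the same size,
  so have these two sets, and the matching is a bijection between them. This set of vertices is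
  thus a union of matching edges for every perfect matching at once.\<close>

lemma stability_system_split_closed:
  assumes cc: "colour_classes V E A B" and pm: "perfect_matching V E M" and "finite V"
    and S: "S \<in> stability_systems V E" and v: "v \<in> (S \<inter> A) \<union> (B - S)"
  shows "partner M v \<in> (S \<inter> A) \<union> (B - S)"
proof -
  have AB: "A \<inter> B = {}" "A \<union> B = V" using cc by (auto simp: colour_classes_def)
  note fin = colour_classes_finite[OF cc \<open>finite V\<close>] and SD = stability_systemsD[OF S]
  have finS: "finite S" using SD(3) \<open>finite V\<close> finite_subset by blast
  have p: "partner M x \<in> B - S" if "x \<in> S \<inter> A" for x
  proof -
    have "{x, partner M x} \<in> E"
      using partner_edge[OF cc pm, of x] that AB pm by (auto simp: perfect_matching_def matching_def)
    then have "partner M x \<notin> S" using SD(1) that by (auto simp: stable_set_def)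
    then show ?thesis using partner_class[OF cc pm] that by blast
  qed
  have "card S = card B"
    using SD(2) perfect_matching_stability_number[OF cc pm \<open>finite V\<close>]
      perfect_matching_card_classes[OF cc pm \<open>finite V\<close>] by simp
  moreover have "card S = card (S \<inter> A) + card (S \<inter> B)"
    using AB SD(3) finS by (subst card_Un_disjoint[symmetric]) (auto intro: arg_cong[where f=card])
  moreover have "card B = card (B - S) + card (S \<inter> B)"
    using fin by (subst card_Un_disjoint[symmetric]) (auto intro: arg_cong[where f=card])
  moreover have "inj_on (partner M) (S \<inter> A)"
    using partner_inj_on[OF cc pm] by (rule inj_on_subset) (use AB in auto)
  ultimately have "card (partner M ` (S \<inter> A)) = card (B - S)"
    by (simp add: card_image)
  then have img: "partner M ` (S \<inter> A) = B - S"
    using fin p by (intro card_subset_eq) auto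
  show ?thesis
  proof (cases "v \<in> S \<inter> A")
    case True
    then show ?thesis using p by blast
  next
    case False
    then have "v \<in> partner M ` (S \<inter> A)" using v img by blast
    then obtain x where x: "x \<in> S \<inter> A" "v = partner M x" by blast
    moreover have "x \<in> V" using x AB by blast
    ultimately show ?thesis using partner_partner[OF cc pm] by simp
  qed
qed

lemma avoidable_edges_two_partners:
  assumes cc: "colour_classes V E A B" and av: "avoidable_edges V E" and "v \<in> V"
  shows "\<exists>M M'. perfect_matching V E M \<and> perfect_matching V E M' \<and> partner M v \<noteq> partner M' v"
proof -
  obtain M where M: "perfect_matching V E M" using av by (auto simp: avoidable_edges_def)
  have e: "{v, partner M v} \<in> M" by (rule partner_edge[OF cc M \<open>v \<in> V\<close>])
  then have "{v, partner M v} \<in> E" using M by (auto simp: perfect_matching_def matching_def)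
  then obtain M' where M': "perfect_matching V E M'" "{v, partner M v} \<notin> M'"
    using av by (auto simp: avoidable_edges_def)
  then have "partner M v \<noteq> partner M' v" using partner_edge[OF cc M'(1) \<open>v \<in> V\<close>] by auto
  then show ?thesis using M M' by blast
qed

lemma avoidable_edges_card_ge:
  assumes cc: "colour_classes V E A B" and av: "avoidable_edges V E" and "finite V"
  shows "4 \<le> card V"
proof -
  have AB: "A \<inter> B = {}" "A \<union> B = V" "A \<noteq> {}" using cc by (auto simp: colour_classes_def)
  note fin = colour_classes_finite[OF cc \<open>finite V\<close>]
  obtain v where v: "v \<in> A" using AB by blast
  then have "v \<in> V" using AB by blast
  then obtain M M' where MM: "perfect_matching V E M" "perfect_matching V E M'"
      "partner M v \<noteq> partner M' v"
    using avoidable_edges_two_partners[OF cc av] by blast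
  have "card {partner M v, partner M' v} \<le> card B"
    using partner_class[OF cc MM(1) v] partner_class[OF cc MM(2) v] fin by (intro card_mono) auto
  then have "2 \<le> card B" using MM by simp
  moreover have "card A = card B" by (rule perfect_matching_card_classes[OF cc MM(1) \<open>finite V\<close>])
  moreover have "card V = card A + card B" using AB fin card_Un_disjoint by blast
  ultimately show ?thesis by linarith
qed

text \<open>Induction on the number of vertices. A graph that is not bistable is split at a third stability
  system; both sides are unions of edges of every perfect matching, so perfect matchings, and with
  them avoidability, restrict to each side. The size bound comes for free, as in a graph
  with avoidable edges every vertex has at least two possible partners in the other class.\<close>

lemma avoidable_edges_decompose:
  assumes "colour_classes V E A B" "avoidable_edges V E" "finite V"
  shows "\<exists>P. partition_on V P \<and>
    (\<forall>W\<in>P. bistable_bipartite W (induced_edges E W) \<and> 4 \<le> card W)"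
  using assms
proof (induction "card V" arbitrary: V E A B rule: less_induct)
  case less
  note cc = less.prems(1) and av = less.prems(2) and fin = less.prems(3)
  have AB: "A \<inter> B = {}" "A \<union> B = V" "A \<noteq> {}" "B \<noteq> {}" using cc by (auto simp: colour_classes_def)
  obtain M where M: "perfect_matching V E M" using av by (auto simp: avoidable_edges_def)
  have alpha: "stability_number V E = card A"
    by (rule perfect_matching_stability_number[OF cc M fin])
  have ABsys: "{A, B} \<subseteq> stability_systems V E"
    using colour_classes_stable[OF cc] alpha perfect_matching_card_classes[OF cc M fin]
    by (auto simp: stability_systems_def)
  show ?case
  proof (cases "stability_systems V E = {A, B}")
    case True
    have "A \<noteq> B" using AB by blast
    then have "bistable_bipartite V E" using True cc by (auto simp: bistable_bipartite_def)
    moreover have "induced_edges E V = E"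
      using cc by (fastforce simp: induced_edges_def colour_classes_def)
    moreover have "partition_on V {V}" using AB by (auto simp: partition_on_def)
    ultimately show ?thesis using avoidable_edges_card_ge[OF cc av fin] by (intro exI[of _ "{V}"]) simp
  next
    case False
    then obtain S where S: "S \<in> stability_systems V E" "S \<noteq> A" "S \<noteq> B" using ABsys by blast
    define W where "W = (S \<inter> A) \<union> (B - S)"
    have SV: "S \<subseteq> V" by (rule stability_systemsD(3)[OF S(1)])
    have WV: "W \<subseteq> V" using AB by (auto simp: W_def)
    have "W \<noteq> {}" "W \<noteq> V" using S(2,3) SV AB unfolding W_def by blast+
    have closed: "partner N v \<in> W" if "perfect_matching V E N" "v \<in> W" for N v
      using stability_system_split_closed[OF cc that(1) fin S(1)] that(2) by (simp add: W_def)
    have closed': "partner N v \<in> V - W" if N: "perfect_matching V E N" and v: "v \<in> V - W" for N v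
    proof -
      have "v \<in> V" using v by blast
      then have "{v, partner N v} \<in> N" by (rule partner_edge[OF cc N])
      then have "partner N v \<in> V" using N by (auto simp: perfect_matching_def)
      moreover have "partner N v \<notin> W"
        using closed[OF N] partner_partner[OF cc N \<open>v \<in> V\<close>] v by fastforce
      ultimately show ?thesis by blast
    qed
    have part: "\<exists>P. partition_on U P \<and>
        (\<forall>W\<in>P. bistable_bipartite W (induced_edges E W) \<and> 4 \<le> card W)"
      if U: "U \<subset> V" "U \<noteq> {}"
        and cl: "\<And>N v. perfect_matching V E N \<Longrightarrow> v \<in> U \<Longrightarrow> partner N v \<in> U" for U
    proof -
      have UV: "U \<subseteq> V" using U by blast
      have "card U < card V" using U fin by (simp add: psubset_card_mono)
      moreover have ccU: "colour_classes U (induced_edges E U) (A \<inter> U) (B \<inter> U)"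
        using colour_classes_induced[OF cc M UV U(2)] cl[OF M] by blast
      moreover have "avoidable_edges U (induced_edges E U)"
        using avoidable_edges_induced[OF cc av UV] cl by blast
      moreover have "finite U" using UV fin finite_subset by blast
      ultimately obtain P where P: "partition_on U P"
        "\<forall>W\<in>P. bistable_bipartite W (induced_edges (induced_edges E U) W) \<and> 4 \<le> card W"
        using less.hyps[of U "induced_edges E U", OF _ ccU] by auto
      have "induced_edges (induced_edges E U) X = induced_edges E X" if "X \<in> P" for X
        using P(1) that by (intro induced_edges_induced) (auto simp: partition_on_def)
      then show ?thesis using P by (intro exI[of _ P]) simp
    qed
    obtain P where P: "partition_on W P"
      "\<forall>W\<in>P. bistable_bipartite W (induced_edges E W) \<and> 4 \<le> card W"
      using part[of W, OF _ \<open>W \<noteq> {}\<close> closed] WV \<open>W \<noteq> V\<close> by auto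
    obtain Q where Q: "partition_on (V - W) Q"
      "\<forall>W\<in>Q. bistable_bipartite W (induced_edges E W) \<and> 4 \<le> card W"
      using part[of "V - W", OF _ _ closed'] WV \<open>W \<noteq> {}\<close> \<open>W \<noteq> V\<close> by auto
    have "X \<inter> Y = {}" if "X \<in> P" "Y \<in> Q" for X Y
      using that P(1) Q(1) unfolding partition_on_def by blast
    then have "disjoint (P \<union> Q)"
      using P(1) Q(1) by (intro disjoint_union) (auto simp: partition_on_def)
    moreover have "\<Union>(P \<union> Q) = V" "{} \<notin> P \<union> Q"
      using P(1) Q(1) WV unfolding partition_on_def by auto
    ultimately have "partition_on V (P \<union> Q)" by (simp add: partition_on_def)
    then show ?thesis using P(2) Q(2) by (intro exI[of _ "P \<union> Q"]) auto
  qed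
qed

text \<open>An unavoidable edge \<open>{a, b}\<close> would make the stability number grow when it is deleted, giving \<open>S\<close>
  with at least three vertices. Then \<open>S - {a}\<close> and \<open>S - {b}\<close> are stability systems with a common
  vertex, so they are the same colour class, which is absurd.\<close>

lemma bistable_bipartite_avoidable_edges:
  assumes bi: "bistable_bipartite V E" and "finite V" "4 \<le> card V"
  shows "avoidable_edges V E"
proof -
  obtain A B where cc: "colour_classes V E A B" and sys: "stability_systems V E = {A, B}"
    using bi by (auto simp: bistable_bipartite_def)
  have AB: "A \<inter> B = {}" "A \<union> B = V" using cc by (auto simp: colour_classes_def)
  note fin = colour_classes_finite[OF cc \<open>finite V\<close>]
  have "A \<in> stability_systems V E" "B \<in> stability_systems V E" using sys by auto
  then have alpha: "stability_number V E = card A" "stability_number V E = card B"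
    by (auto dest: stability_systemsD(2))
  have "card V = card A + card B" using AB fin card_Un_disjoint by blast
  then have "2 \<le> card A" using alpha assms(3) by linarith
  have "\<exists>M. perfect_matching V (E - {e}) M" if e: "e \<in> E" for e
  proof (rule ccontr)
    assume none: "\<nexists>M. perfect_matching V (E - {e}) M"
    have cc': "colour_classes V (E - {e}) A B" by (rule colour_classes_mono[OF cc Diff_subset])
    have gt: "stability_number V (E - {e}) > card A"
      using none ex_perfect_matching[OF cc' \<open>finite V\<close>] alpha by fastforce
    obtain S where S: "S \<in> stability_systems V (E - {e})"
      using ex_stability_system[OF \<open>finite V\<close>] by blast
    note SD = stability_systemsD[OF S]
    have finS: "finite S" using SD(3) \<open>finite V\<close> finite_subset by blast
    obtain a b where ab: "a \<in> A" "b \<in> B" "e = {a, b}"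
      using cc e unfolding colour_classes_def by blast
    have "a \<noteq> b" using ab AB by blast
    have "\<not> stable_set V E S"
      using stable_set_card_le[OF \<open>finite V\<close>, of E S] gt SD(2) alpha by fastforce
    then have abS: "a \<in> S" "b \<in> S"
      using SD(1) ab(3) unfolding stable_set_def by (auto simp: doubleton_eq_iff)
    have max: "S - {x} \<in> {A, B}" if "x \<in> {a, b}" for x
    proof -
      have "stable_set V E (S - {x})"
        using SD(1) that ab(3) unfolding stable_set_def by (auto simp: doubleton_eq_iff)
      moreover have "stability_number V E \<le> card (S - {x})"
        using that abS gt SD(2) alpha finS by auto
      ultimately have "S - {x} \<in> stability_systems V E"
        by (rule stability_systemsI[OF \<open>finite V\<close>])
      then show ?thesis by (simp only: sys)
    qed
    have "\<not> S \<subseteq> {a, b}"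
    proof
      assume "S \<subseteq> {a, b}"
      then have "card S \<le> card {a, b}" by (intro card_mono) auto
      then show False using gt SD(2) \<open>2 \<le> card A\<close> \<open>a \<noteq> b\<close> by simp
    qed
    then obtain x where x: "x \<in> S - {a}" "x \<in> S - {b}" by blast
    have "S - {a} = S - {b}" using max[of a] max[of b] x AB by blast
    then show False using abS \<open>a \<noteq> b\<close> by blast
  qed
  moreover have "\<exists>M. perfect_matching V E M"
    using ex_perfect_matching[OF cc \<open>finite V\<close>] alpha by simp
  ultimately show ?thesis unfolding avoidable_edges_def perfect_matching_Diff by blast
qed

lemma perfect_matching_UN:
  assumes dis: "disjoint_family_on W I" and un: "(\<Union>i\<in>I. W i) = V"
    and pm: "\<And>i. i \<in> I \<Longrightarrow> perfect_matching (W i) (induced_edges E (W i)) (M i)"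
  shows "perfect_matching V E (\<Union>i\<in>I. M i)"
proof -
  have sub: "e \<subseteq> W i" "e \<in> E" if "i \<in> I" "e \<in> M i" for i e
    using pm[OF that(1)] that(2) by (auto simp: perfect_matching_def matching_def induced_edges_def)
  have "disjoint (\<Union>i\<in>I. M i)"
    unfolding disjoint_def
  proof (intro ballI impI)
    fix e f assume "e \<in> (\<Union>i\<in>I. M i)" "f \<in> (\<Union>i\<in>I. M i)" "e \<noteq> f"
    then obtain i j where ij: "i \<in> I" "j \<in> I" "e \<in> M i" "f \<in> M j" by blast
    show "e \<inter> f = {}"
    proof (cases "i = j")
      case True
      then show ?thesis
        using pm[OF ij(1)] ij \<open>e \<noteq> f\<close> by (auto simp: perfect_matching_def matching_def disjoint_def)
    next
      case False
      then have "W i \<inter> W j = {}" using dis ij by (auto simp: disjoint_family_on_def)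
      then show ?thesis using sub[OF ij(1,3)] sub[OF ij(2,4)] by blast
    qed
  qed
  moreover have "(\<Union>i\<in>I. M i) \<subseteq> E" using sub by blast
  moreover have "\<Union>(\<Union>i\<in>I. M i) = (\<Union>i\<in>I. \<Union>(M i))" by blast
  moreover have "\<dots> = V" using pm un by (simp add: perfect_matching_def)
  ultimately show ?thesis by (simp add: perfect_matching_def matching_def)
qed

text \<open>A given edge is avoided in each part separately: either it belongs to the part, or no matching of
  the part can use it.\<close>

lemma avoidable_edges_UN:
  assumes dis: "disjoint_family_on W I" and un: "(\<Union>i\<in>I. W i) = V"
    and av: "\<And>i. i \<in> I \<Longrightarrow> avoidable_edges (W i) (induced_edges E (W i))"
  shows "avoidable_edges V E"
proof -
  have avoid: "\<exists>M. perfect_matching V E M \<and> e \<notin> M" for e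
  proof -
    have "\<forall>i\<in>I. \<exists>M. perfect_matching (W i) (induced_edges E (W i)) M \<and> e \<notin> M"
    proof
      fix i assume i: "i \<in> I"
      show "\<exists>M. perfect_matching (W i) (induced_edges E (W i)) M \<and> e \<notin> M"
      proof (cases "e \<in> induced_edges E (W i)")
        case True
        then show ?thesis using av[OF i] by (auto simp: avoidable_edges_def)
      next
        case False
        moreover obtain M where "perfect_matching (W i) (induced_edges E (W i)) M"
          using av[OF i] by (auto simp: avoidable_edges_def)
        ultimately show ?thesis by (auto simp: perfect_matching_def matching_def)
      qed
    qed
    then obtain M where M: "\<forall>i\<in>I. perfect_matching (W i) (induced_edges E (W i)) (M i) \<and> e \<notin> M i"
      unfolding bchoice_iff by blast
    have "perfect_matching V E (\<Union>i\<in>I. M i)"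
      by (rule perfect_matching_UN[OF dis un]) (use M in blast)
    moreover have "e \<notin> (\<Union>i\<in>I. M i)" using M by blast
    ultimately show ?thesis by blast
  qed
  then show ?thesis unfolding avoidable_edges_def by blast
qed

lemma avoidable_edges_iff_bistable_decomposition:
  assumes cc: "colour_classes V E A B" and "finite V"
  shows "avoidable_edges V E \<longleftrightarrow> (\<exists>k W. 1 \<le> k \<and> vertex_decomposition V k W \<and>
    (\<forall>i\<in>{1..k}. bistable_bipartite (W i) (induced_edges E (W i)) \<and> 4 \<le> card (W i)))"
    (is "_ \<longleftrightarrow> ?D")
proof
  assume "avoidable_edges V E"
  then obtain P where P: "partition_on V P"
    "\<forall>W\<in>P. bistable_bipartite W (induced_edges E W) \<and> 4 \<le> card W"
    using avoidable_edges_decompose[OF cc _ \<open>finite V\<close>] by blast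
  have "finite P" using P(1) \<open>finite V\<close> finite_elements by blast
  then obtain W where W: "bij_betw W {1..card P} P" using ex_bij_betw_nat_finite_1 by blast
  have "V \<noteq> {}" using cc by (auto simp: colour_classes_def)
  then have "P \<noteq> {}" using P(1) by (auto simp: partition_on_def)
  then have "1 \<le> card P" using \<open>finite P\<close> by (simp add: Suc_le_eq card_gt_0_iff)
  moreover have img: "W ` {1..card P} = P" and inj: "inj_on W {1..card P}"
    using W by (auto simp: bij_betw_def)
  have "disjoint_family_on W {1..card P}"
    unfolding disjoint_family_on_def
  proof (intro ballI impI)
    fix i j assume ij: "i \<in> {1..card P}" "j \<in> {1..card P}" "i \<noteq> j"
    then have "W i \<noteq> W j" using inj_onD[OF inj] by blast
    moreover have "W i \<in> P" "W j \<in> P" using ij img by blast+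
    ultimately show "W i \<inter> W j = {}" using P(1) by (auto simp: partition_on_def disjoint_def)
  qed
  moreover have "(\<Union>i\<in>{1..card P}. W i) = V" using img P(1) by (simp add: partition_on_def)
  ultimately show ?D
    using P(2) img unfolding vertex_decomposition_def by (intro exI[of _ "card P"] exI[of _ W]) blast
next
  assume ?D
  then obtain k W where dec: "vertex_decomposition V k W"
    and parts: "\<forall>i\<in>{1..k}. bistable_bipartite (W i) (induced_edges E (W i)) \<and> 4 \<le> card (W i)"
    by blast
  have W: "disjoint_family_on W {1..k}" "(\<Union>i\<in>{1..k}. W i) = V"
    using dec by (simp_all add: vertex_decomposition_def)
  show "avoidable_edges V E"
  proof (rule avoidable_edges_UN[OF W])
    fix i assume i: "i \<in> {1..k}"
    have "W i \<subseteq> V" using W(2) i by blast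
    then have "finite (W i)" using \<open>finite V\<close> by (rule finite_subset)
    then show "avoidable_edges (W i) (induced_edges E (W i))"
      using bistable_bipartite_avoidable_edges parts i by blast
  qed
qed

section \<open>Two matching edges at every vertex\<close>

text \<open>An unavoidable edge would be the only matching edge available at its ends.\<close>

lemma avoidable_edges_iff_two_matching_edges:
  assumes cc: "colour_classes V E A B" and "finite V"
  shows "avoidable_edges V E \<longleftrightarrow>
    (\<forall>v\<in>V. 2 \<le> card {e \<in> E. v \<in> e \<and> (\<exists>M. perfect_matching V E M \<and> e \<in> M)})"
    (is "_ \<longleftrightarrow> (\<forall>v\<in>V. 2 \<le> card (?D v))")
proof
  assume av: "avoidable_edges V E"
  show "\<forall>v\<in>V. 2 \<le> card (?D v)"
  proof
    fix v assume v: "v \<in> V"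
    obtain M M' where MM: "perfect_matching V E M" "perfect_matching V E M'"
        "partner M v \<noteq> partner M' v"
      using avoidable_edges_two_partners[OF cc av v] by blast
    let ?e = "{v, partner M v}" and ?f = "{v, partner M' v}"
    have "?e \<in> M" "?f \<in> M'" using partner_edge[OF cc _ v] MM by blast+
    moreover have "M \<subseteq> E" "M' \<subseteq> E" using MM by (auto simp: perfect_matching_def matching_def)
    ultimately have "{?e, ?f} \<subseteq> ?D v" using MM(1,2) by blast
    moreover have "finite (?D v)"
    proof (rule finite_subset)
      show "?D v \<subseteq> Pow V" by (auto simp: perfect_matching_def)
    qed (simp add: \<open>finite V\<close>)
    ultimately have "card {?e, ?f} \<le> card (?D v)" by (intro card_mono)
    moreover have "?e \<noteq> ?f" using MM(3) by (auto simp: doubleton_eq_iff)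
    ultimately show "2 \<le> card (?D v)" by simp
  qed
next
  assume two: "\<forall>v\<in>V. 2 \<le> card (?D v)"
  have other: "\<exists>f M. f \<noteq> e \<and> v \<in> f \<and> perfect_matching V E M \<and> f \<in> M" if "v \<in> V" for v e
  proof -
    have "\<not> ?D v \<subseteq> {e}"
    proof
      assume "?D v \<subseteq> {e}"
      then have "card (?D v) \<le> card {e}" by (intro card_mono) auto
      then show False using two that by fastforce
    qed
    then show ?thesis by blast
  qed
  have "V \<noteq> {}" using cc by (auto simp: colour_classes_def)
  then have "\<exists>M. perfect_matching V E M" using other by blast
  moreover have "\<exists>M. perfect_matching V E M \<and> e \<notin> M" if e: "e \<in> E" for e
  proof -
    obtain v w where vw: "v \<in> A" "e = {v, w}"
      using cc e unfolding colour_classes_def by blast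
    then have v: "v \<in> e" "v \<in> V" using cc by (auto simp: colour_classes_def)
    obtain f M where f: "f \<noteq> e" "v \<in> f" "perfect_matching V E M" "f \<in> M"
      using other[OF v(2), of e] by (elim exE conjE)
    then have "e \<notin> M" using perfect_matching_unique[OF f(3)] v(1) by blast
    then show ?thesis using f(3) by blast
  qed
  ultimately show "avoidable_edges V E" by (simp add: avoidable_edges_def)
qed

section \<open>Alternating cycles\<close>

text \<open>A vertex of a cycle lies on two consecutive cycle edges and on no others.\<close>

lemma cycle_edges_at_vertex:
  assumes "distinct c" "c \<noteq> []" "x \<in> set c"
  obtains j where "j < length c"
    "{k. k < length c \<and> x \<in> cycle_edge c k} \<subseteq> {j, Suc j mod length c}"
    "x \<in> cycle_edge c j" "x \<in> cycle_edge c (Suc j)"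
proof -
  let ?n = "length c"
  obtain i where i: "i < ?n" "x = c ! i" using assms(3) by (auto simp: in_set_conv_nth)
  define j where "j = (if i = 0 then ?n - 1 else i - 1)"
  have j: "j < ?n" "Suc j mod ?n = i" using i by (auto simp: j_def mod_Suc)
  have edges: "k = j \<or> k = i" if k: "k < ?n" "x \<in> cycle_edge c k" for k
  proof -
    have "Suc k mod ?n < ?n" using assms(2) by simp
    then have "k = i \<or> Suc k mod ?n = Suc j mod ?n"
      using k i j assms(1) by (auto simp: cycle_edge_def nth_eq_iff_index_eq)
    then show ?thesis using k(1) j(1) by (auto simp: mod_Suc split: if_splits)
  qed
  show ?thesis
  proof (rule that)
    show "{k. k < ?n \<and> x \<in> cycle_edge c k} \<subseteq> {j, Suc j mod ?n}" using edges j(2) by blast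
  qed (use j i in \<open>simp_all add: cycle_edge_def\<close>)
qed

lemma cycle_edge_mod: "cycle_edge c (k mod length c) = cycle_edge c k"
  by (simp add: cycle_edge_def mod_Suc_eq)

text \<open>At every vertex of the cycle exactly one of its two cycle edges is in the matching \<open>M\<close>. Hence the
  symmetric difference of \<open>M\<close> with the cycle is again a perfect matching, and it misses every
  matching edge at a vertex of the cycle, as that edge lies on the cycle.\<close>

lemma alternating_cycle_avoids:
  assumes cc: "colour_classes V E A B" and c: "alternating_cycle V E c" and v: "v \<in> set c" "v \<in> e"
  shows "\<exists>M. perfect_matching V E M \<and> e \<notin> M"
proof (rule ccontr)
  assume always: "\<nexists>M. perfect_matching V E M \<and> e \<notin> M"
  obtain M where M: "perfect_matching V E M"
    and alt: "\<And>i. i < length c \<Longrightarrow> cycle_edge c i \<in> M \<longleftrightarrow> cycle_edge c (Suc i) \<notin> M"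
    using c by (auto simp: alternating_cycle_def)
  have dc: "distinct c" "c \<noteq> []" and cE: "\<And>i. i < length c \<Longrightarrow> cycle_edge c i \<in> E"
    using c by (auto simp: alternating_cycle_def graph_cycle_def)
  define C where "C = cycle_edge c ` {..<length c}"
  \<comment> \<open>The cycle edges at \<open>x\<close> are one edge \<open>f\<close> in the matching and one edge \<open>g\<close> outside it.\<close>
  have at: "\<exists>f g. f \<in> C \<inter> M \<and> g \<in> C - M \<and> x \<in> f \<and> x \<in> g \<and> (\<forall>h\<in>C. x \<in> h \<longrightarrow> h = f \<or> h = g)"
    if x: "x \<in> set c" for x
  proof -
    obtain j where j: "j < length c"
      "{k. k < length c \<and> x \<in> cycle_edge c k} \<subseteq> {j, Suc j mod length c}"
      "x \<in> cycle_edge c j" "x \<in> cycle_edge c (Suc j)"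
      using cycle_edges_at_vertex[OF dc x] by blast
    have "Suc j mod length c < length c" using dc by simp
    then have "cycle_edge c j \<in> C" "cycle_edge c (Suc j mod length c) \<in> C"
      using j(1) unfolding C_def by blast+
    then have "cycle_edge c j \<in> C" "cycle_edge c (Suc j) \<in> C"
      by (simp_all only: cycle_edge_mod)
    moreover have "h = cycle_edge c j \<or> h = cycle_edge c (Suc j)" if "h \<in> C" "x \<in> h" for h
      using that j(2) cycle_edge_mod[of c "Suc j"] by (auto simp: C_def)
    ultimately show ?thesis using alt[OF j(1)] j(3,4) by blast
  qed
  have in_c: "x \<in> set c" if h: "h \<in> C" "x \<in> h" for h x
  proof -
    obtain k where "h = cycle_edge c k" using h(1) by (auto simp: C_def)
    then show ?thesis using h(2) dc(2) by (auto simp: cycle_edge_def)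
  qed
  let ?N = "(M - C) \<union> (C - M)"
  have uniq: "f = g" if fg: "f \<in> ?N" "g \<in> ?N" "x \<in> f" "x \<in> g" for f g x
  proof (cases "x \<in> set c")
    case True
    then obtain f' g' where fg': "f' \<in> C \<inter> M" "x \<in> f'" "\<forall>h\<in>C. x \<in> h \<longrightarrow> h = f' \<or> h = g'"
      using at by metis
    have "h = g'" if "h \<in> ?N" "x \<in> h" for h
      using perfect_matching_unique[OF M, of h f' x] fg' that by blast
    then show ?thesis using fg by blast
  next
    case False
    then have "f \<in> M" "g \<in> M" using fg in_c by blast+
    then show ?thesis using perfect_matching_unique[OF M] fg(3,4) by blast
  qed
  have NE: "?N \<subseteq> E" using M cE by (auto simp: C_def perfect_matching_def matching_def)
  have "\<Union>?N = V"
  proof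
    show "\<Union>?N \<subseteq> V" using NE cc by (fastforce simp: colour_classes_def)
    show "V \<subseteq> \<Union>?N"
    proof
      fix x assume "x \<in> V"
      then obtain f where f: "f \<in> M" "x \<in> f" using M by (auto simp: perfect_matching_def)
      show "x \<in> \<Union>?N"
      proof (cases "x \<in> set c")
        case True
        then show ?thesis using at by blast
      next
        case False
        then show ?thesis using f in_c by blast
      qed
    qed
  qed
  moreover have "disjoint ?N" unfolding disjoint_def using uniq by blast
  ultimately have "perfect_matching V E ?N" using NE by (simp add: perfect_matching_def matching_def)
  then have "e \<in> ?N" "e \<in> M" using always M by blast+
  moreover obtain f where "f \<in> C \<inter> M" "v \<in> f" using at[OF v(1)] by blast
  ultimately show False using perfect_matching_unique[OF M, of e f v] v(2) by blast
qed

text \<open>Going from a vertex of \<open>A\<close> along an edge of \<open>M\<close> and then along one of \<open>M'\<close> is an injective map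
  \<open>f\<close> of the finite set \<open>A\<close> to itself, so \<open>v\<close> lies on a periodic orbit. The orbit together with
  the intermediate vertices in \<open>B\<close> is the cycle. It has length at least four, and its \<open>M'\<close>-edges
  are not in \<open>M\<close>, because \<open>f\<close> fixes no vertex of the orbit: by injectivity a fixed point would
  force \<open>f v = v\<close>, that is, \<open>v\<close> would have the same partner in both matchings.\<close>

lemma ex_alternating_cycle_through_class:
  assumes cc: "colour_classes V E A B" and "finite V"
    and M: "perfect_matching V E M" and M': "perfect_matching V E M'"
    and ne: "partner M v \<noteq> partner M' v" and v: "v \<in> A"
  shows "\<exists>c. alternating_cycle V E c \<and> v \<in> set c"
proof -
  have AB: "A \<subseteq> V" "B \<subseteq> V" "A \<inter> B = {}" using cc by (auto simp: colour_classes_def)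
  note fin = colour_classes_finite[OF cc \<open>finite V\<close>]
  note cc' = colour_classes_sym[OF cc]
  define f where "f a = partner M' (partner M a)" for a
  define x where "x i = (f ^^ i) v" for i
  have fA: "f a \<in> A" if "a \<in> A" for a
    using partner_class[OF cc' M' partner_class[OF cc M that]] by (simp add: f_def)
  have f_inj: "a = b" if "f a = f b" "a \<in> A" "b \<in> A" for a b
  proof -
    have V: "a \<in> V" "b \<in> V" "partner M a \<in> V" "partner M b \<in> V"
      using that(2,3) partner_class[OF cc M] AB(1,2) by blast+
    have "partner M a = partner M b"
      using inj_onD[OF partner_inj_on[OF cc M'] _ V(3,4)] that(1) by (simp add: f_def)
    then show ?thesis using inj_onD[OF partner_inj_on[OF cc M] _ V(1,2)] by simp
  qed
  have xA: "x i \<in> A" for i by (induction i) (auto simp: x_def v fA)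
  have xS: "x (Suc i) = f (x i)" for i by (simp add: x_def)
  have x0: "x 0 = v" by (simp add: x_def)
  \<comment> \<open>Repetitions in the orbit can be moved back to its start, which makes it purely periodic.\<close>
  have shift: "x d = v" if "x (i + d) = x i" for i d
    using that by (induction i) (auto simp: xS x0 xA dest!: f_inj)
  have "\<exists>d>0. x d = v"
  proof -
    have "finite (range x)" using xA fin finite_subset[of "range x" A] by blast
    then have "\<not> inj x" using finite_imageD by blast
    then obtain i j where "i < j" "x i = x j" by (metis injI linorder_neqE_nat)
    then show ?thesis using shift[of i "j - i"] by (intro exI[of _ "j - i"]) auto
  qed
  then obtain p where p: "p > 0" "x p = v" and p_least: "\<And>d. 0 < d \<Longrightarrow> d < p \<Longrightarrow> x d \<noteq> v"
    using exists_least_iff[of "\<lambda>d. d > 0 \<and> x d = v"] by blast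
  have x_inj: "i = j" if "x i = x j" "i < p" "j < p" for i j
  proof (rule ccontr)
    have *: "False" if "k < l" "x k = x l" "l < p" for k l
      using shift[of k "l - k"] p_least[of "l - k"] that by simp
    assume "i \<noteq> j"
    then show False using *[of i j] *[of j i] that by (metis linorder_neqE_nat)
  qed
  have f_ne: "f (x i) \<noteq> x i" for i
  proof
    assume "f (x i) = x i"
    then have "f v = v" using shift[of i 1] by (simp add: xS x0)
    moreover have "v \<in> V" "partner M v \<in> V" using v AB partner_class[OF cc M v] by blast+
    ultimately show False
      using ne partner_partner[OF cc M'] unfolding f_def by metis
  qed
  have "x 1 \<noteq> v" using f_ne[of 0] xS[of 0] x0 by simp
  then have "p \<noteq> 1" using p(2) by blast
  define y where "y k = (if even k then x (k div 2) else partner M (x (k div 2)))" for k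
  define n where "n = 2 * p"
  define c where "c = map y [0..<n]"
  have len: "length c = n" by (simp add: c_def)
  have n4: "4 \<le> n" using p(1) \<open>p \<noteq> 1\<close> by (simp add: n_def)
  have yB: "y k \<in> (if even k then A else B)" for k
    using xA partner_class[OF cc M] by (auto simp: y_def)
  have "inj_on y {0..<n}"
  proof (rule inj_onI)
    fix k l assume kl: "k \<in> {0..<n}" "l \<in> {0..<n}" "y k = y l"
    then have par: "even k \<longleftrightarrow> even l" using yB[of k] yB[of l] AB by (auto split: if_splits)
    have "x (k div 2) = x (l div 2)"
    proof (cases "even k")
      case True
      then show ?thesis using kl(3) par by (simp add: y_def)
    next
      case False
      then have "partner M (x (k div 2)) = partner M (x (l div 2))"
        using kl(3) par by (simp add: y_def)
      moreover have "x i \<in> V" for i using xA AB(1) by blast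
      ultimately show ?thesis using inj_onD[OF partner_inj_on[OF cc M]] by blast
    qed
    moreover have "k div 2 < p" "l div 2 < p" using kl by (auto simp: n_def)
    ultimately have "k div 2 = l div 2" by (rule x_inj)
    then show "k = l" using par by (metis div_mult_mod_eq parity_cases)
  qed
  then have "distinct c" by (simp add: c_def distinct_map)
  \<comment> \<open>The bound \<open>Suc n\<close> is needed since the alternation condition at the closing edge, of index
    \<open>n - 1\<close>, refers to the edge of index \<open>n\<close>, which is the first one again.\<close>
  have wrap: "c ! (k mod n) = y k" if k: "k \<le> Suc n" for k
  proof -
    have nth: "c ! l = y l" if "l < n" for l using that by (simp add: c_def)
    consider "k < n" | "k = n" | "k = Suc n" using k by linarith
    then show ?thesis
    proof cases
      case 1
      then show ?thesis using nth by simp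
    next
      case 2
      then show ?thesis using nth[of 0] n4 p x0 by (simp add: y_def n_def)
    next
      case 3
      then have "k mod n = 1" using n4 by (simp add: mod_Suc)
      then show ?thesis using 3 nth[of 1] n4 p x0 by (simp add: y_def n_def)
    qed
  qed
  have edge: "cycle_edge c k = {y k, y (Suc k)}" if "k \<le> n" for k
    using that wrap[of k] wrap[of "Suc k"] by (simp add: cycle_edge_def len)
  have y_edge: "{y k, y (Suc k)} \<in> E \<and> ({y k, y (Suc k)} \<in> M \<longleftrightarrow> even k)" for k
  proof -
    have ME: "M \<subseteq> E" "M' \<subseteq> E" using M M' by (auto simp: perfect_matching_def matching_def)
    let ?a = "x (k div 2)"
    let ?b = "partner M ?a"
    have ab: "?a \<in> V" "?b \<in> V" using xA partner_class[OF cc M xA] AB by blast+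
    show ?thesis
    proof (cases "even k")
      case True
      then show ?thesis using partner_edge[OF cc M ab(1)] ME by (auto simp: y_def)
    next
      case False
      then have k: "y k = ?b" "y (Suc k) = f ?a" by (auto simp: y_def xS)
      have "{?b, f ?a} \<in> M'" using partner_edge[OF cc M' ab(2)] by (simp add: f_def)
      moreover have "{?b, f ?a} \<notin> M"
        using partner_eq[OF cc M, of ?b "f ?a"] partner_partner[OF cc M ab(1)] f_ne by metis
      ultimately show ?thesis using k False ME by auto
    qed
  qed
  have "graph_cycle E c"
    using n4 \<open>distinct c\<close> edge y_edge by (simp add: graph_cycle_def len)
  moreover have "\<forall>i<length c. cycle_edge c i \<in> M \<longleftrightarrow> cycle_edge c (Suc i) \<notin> M"
    using edge y_edge by (simp add: len)
  ultimately have "alternating_cycle V E c" using M by (auto simp: alternating_cycle_def)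
  moreover have "c ! 0 = v" using wrap[of 0] by (simp add: y_def x0)
  then have "v \<in> set c" using len n4 nth_mem[of 0 c] by simp
  ultimately show ?thesis by blast
qed

lemma avoidable_edges_iff_alternating_cycles:
  assumes cc: "colour_classes V E A B" and "finite V"
  shows "avoidable_edges V E \<longleftrightarrow> (\<forall>v\<in>V. \<exists>c. alternating_cycle V E c \<and> v \<in> set c)"
proof
  assume av: "avoidable_edges V E"
  show "\<forall>v\<in>V. \<exists>c. alternating_cycle V E c \<and> v \<in> set c"
  proof
    fix v assume v: "v \<in> V"
    obtain M M' where MM: "perfect_matching V E M" "perfect_matching V E M'"
        "partner M v \<noteq> partner M' v"
      using avoidable_edges_two_partners[OF cc av v] by blast
    have "v \<in> A \<or> v \<in> B" using v cc by (auto simp: colour_classes_def)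
    then show "\<exists>c. alternating_cycle V E c \<and> v \<in> set c"
      using ex_alternating_cycle_through_class[OF cc \<open>finite V\<close> MM]
        ex_alternating_cycle_through_class[OF colour_classes_sym[OF cc] \<open>finite V\<close> MM] by blast
  qed
next
  assume cyc: "\<forall>v\<in>V. \<exists>c. alternating_cycle V E c \<and> v \<in> set c"
  have "V \<noteq> {}" using cc by (auto simp: colour_classes_def)
  then have "\<exists>M. perfect_matching V E M" using cyc by (auto simp: alternating_cycle_def)
  moreover have "\<exists>M. perfect_matching V E M \<and> e \<notin> M" if e: "e \<in> E" for e
  proof -
    obtain v w where vw: "v \<in> A" "e = {v, w}"
      using cc e unfolding colour_classes_def by blast
    then have v: "v \<in> e" "v \<in> V" using cc by (auto simp: colour_classes_def)
    then obtain c where "alternating_cycle V E c" "v \<in> set c" using cyc by blast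
    then show ?thesis using alternating_cycle_avoids[OF cc _ _ v(1)] by blast
  qed
  ultimately show "avoidable_edges V E" by (simp add: avoidable_edges_def)
qed

section \<open>The five characterisations\<close>

text \<open>Both colour classes are nonempty, so a path leads from \<open>v\<close> to another vertex.\<close>

lemma connected_bipartite_has_neighbour:
  assumes con: "connected_graph V E" and cc: "colour_classes V E A B" and v: "v \<in> V"
  shows "\<exists>w. {v, w} \<in> E"
proof -
  obtain u where u: "u \<in> V" "u \<noteq> v"
    using cc unfolding colour_classes_def by blast
  then have "(v, u) \<in> {(x, y). {x, y} \<in> E}\<^sup>*" using con v by (auto simp: connected_graph_def)
  then show ?thesis using u(2) by (cases rule: converse_rtranclE) auto
qed

theorem theorem5p6:
  fixes V :: "'a set" and E :: "'a set set"
  assumes "finite_simple_graph V E"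
    and "connected_graph V E"
    and "bipartite_graph V E"
  shows
    "(alpha_stable V E \<longleftrightarrow>
        (\<exists>k W. 1 \<le> k \<and> vertex_decomposition V k W \<and>
           (\<forall>i\<in>{1..k}. bistable_bipartite (W i) (induced_edges E (W i)) \<and> 4 \<le> card (W i)))) \<and>
     (alpha_stable V E \<longleftrightarrow>
        (\<exists>M. perfect_matching V E M) \<and> \<Inter>{M. perfect_matching V E M} = {}) \<and>
     (alpha_stable V E \<longleftrightarrow>
        (\<forall>v\<in>V. 2 \<le> card {e \<in> E. v \<in> e \<and> (\<exists>M. perfect_matching V E M \<and> e \<in> M)})) \<and>
     (alpha_stable V E \<longleftrightarrow>
        (\<forall>v\<in>V. \<exists>c. alternating_cycle V E c \<and> v \<in> set c))"
proof -
  have fin: "finite V" using assms(1) by (simp add: finite_simple_graph_def)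
  obtain A B where cc: "colour_classes V E A B" using assms(3) by (auto simp: bipartite_graph_def)
  have "alpha_stable V E \<longleftrightarrow> avoidable_edges V E"
    using alpha_stable_iff_avoidable_edges[OF cc fin] connected_bipartite_has_neighbour[OF assms(2) cc]
    by blast
  then show ?thesis
    by (simp only: avoidable_edges_iff_bistable_decomposition[OF cc fin, symmetric]
        avoidable_edges_iff_Inter[symmetric]
        avoidable_edges_iff_two_matching_edges[OF cc fin, symmetric]
        avoidable_edges_iff_alternating_cycles[OF cc fin, symmetric])
qed

end
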